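(* Let $G=(V,A)$ be a permutation DAG and $\gamma$ a topological ordering of $V$ such that $\alpha(G,\gamma)$ is finite. Then $$\alpha(G,\gamma)=1+\max\Big\{\sum_{e\in P}w(e) : P \text{ is a (directed) path in } H(G,\gamma)\Big\}.$$
   Context: For a sequence $\sigma=(\sigma(1),\ldots,\sigma(n))$, $\mathsf{PermDAG}(\sigma)$ has vertex set $\{t_1,\ldots,t_n\}$ and an arc $(t_j,t_i)$ for every $i<j$ with $\sigma(i)\le\sigma(j)$. A directed graph is a permutation DAG if it is isomorphic to $\mathsf{PermDAG}(\tau)$ for some sequence $\tau$. A topological ordering of an $n$-vertex DAG $G=(V,A)$ is a bijection $\gamma:V\to[n]$ with $\gamma(u)<\gamma(v)$ for every arc $(v,u)\in A$. $\alpha(G,\gamma)$ is the minimum $k$ such that some $\tau\in[k]^n$ has $\mathsf{PermDAG}(\tau)$ isomorphic to $G$ under $\phi(t_i)=\gamma^{-1}(i)$ ($\infty$ if none exists). Let $\overrightarrow{E}:=\{(u,v):\gamma(u)<\gamma(v)\text{ and }(v,u)\notin A\}$, $H(G,\gamma):=(V,A\cup\overrightarrow{E})$, and $w:A\cup\overrightarrow{E}\to\{0,1\}$ with $w(e)=0$ for $e\in A$ and $w(e)=1$ for $e\in\overrightarrow{E}$. *)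

theory Defs
  imports
    "Graph_Theory.Pair_Digraph"
    "Graph_Theory.Digraph_Isomorphism"
    "HOL-Library.Extended_Nat"
begin

(* The vertex t_i is represented by the number i in {1..n}; sequences are lists, so that
   \<sigma>(i) is the list entry with (zero-based) index i - 1. *)
definition PermDAG :: "nat list \<Rightarrow> nat pair_pre_digraph" where
  "PermDAG \<sigma> =
    \<lparr> pverts = {1..length \<sigma>},
      parcs = {(j, i). 1 \<le> i \<and> i < j \<and> j \<le> length \<sigma> \<and> \<sigma> ! (i - 1) \<le> \<sigma> ! (j - 1)} \<rparr>"

definition permutation_DAG :: "'a pair_pre_digraph \<Rightarrow> bool" where
  "permutation_DAG G \<longleftrightarrow> (\<exists>\<tau>. digraph_iso (with_proj (PermDAG \<tau>)) (with_proj G))"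

definition topological_ordering :: "'a pair_pre_digraph \<Rightarrow> ('a \<Rightarrow> nat) \<Rightarrow> bool" where
  "topological_ordering G \<gamma> \<longleftrightarrow>
    bij_betw \<gamma> (pverts G) {1..card (pverts G)} \<and> (\<forall>(v, u) \<in> parcs G. \<gamma> u < \<gamma> v)"

(* As digraph_iso, with the vertex map prescribed to be \<phi>. *)
definition iso_under ::
    "('a \<Rightarrow> 'b) \<Rightarrow> 'a pair_pre_digraph \<Rightarrow> 'b pair_pre_digraph \<Rightarrow> bool" where
  "iso_under \<phi> G H \<longleftrightarrow>
    (\<exists>f. pre_digraph.digraph_isomorphism (with_proj G) f \<and> with_proj H = app_iso f (with_proj G) \<and>
      (\<forall>v \<in> pverts G. iso_verts f v = \<phi> v))"

lemma iso_under_iff: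
  assumes "pair_wf_digraph G"
  shows "iso_under \<phi> G H \<longleftrightarrow>
    bij_betw \<phi> (pverts G) (pverts H) \<and> parcs H = map_prod \<phi> \<phi> ` parcs G"
proof -
  interpret pair_wf_digraph G by fact
  have wf: "wf_digraph (with_proj G)" by unfold_locales
  have ends: "fst a \<in> pverts G" "snd a \<in> pverts G" if "a \<in> parcs G" for a
    using that arc_fst_in_verts arc_snd_in_verts by auto
  show ?thesis
  proof
    assume "iso_under \<phi> G H"
    then obtain f where
      f: "pre_digraph.digraph_isomorphism (with_proj G) f"
      and H: "with_proj H = app_iso f (with_proj G)"
      and \<phi>: "\<forall>v \<in> pverts G. iso_verts f v = \<phi> v"
      unfolding iso_under_def by blast
    from H have H': "pverts H = iso_verts f ` pverts G" "parcs H = iso_arcs f ` parcs G"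
      "iso_tail f = fst" "iso_head f = snd"
      by (auto simp: with_proj_def app_iso_def)
    have arcs: "iso_arcs f a = map_prod \<phi> \<phi> a" if "a \<in> parcs G" for a
      using f that \<phi> ends[OF that] H'(3,4)
      by (auto simp: pre_digraph.digraph_isomorphism_def prod_eq_iff)
    have "inj_on \<phi> (pverts G)"
      using f \<phi> by (auto simp: pre_digraph.digraph_isomorphism_def inj_on_def)
    moreover have "pverts H = \<phi> ` pverts G" using H'(1) \<phi> by auto
    moreover have "parcs H = map_prod \<phi> \<phi> ` parcs G"
      using H'(2) arcs by (metis image_cong)
    ultimately show "bij_betw \<phi> (pverts G) (pverts H) \<and> parcs H = map_prod \<phi> \<phi> ` parcs G"
      by (simp add: bij_betw_def)
  next
    assume R: "bij_betw \<phi> (pverts G) (pverts H) \<and> parcs H = map_prod \<phi> \<phi> ` parcs G"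
    let ?f = "\<lparr>iso_verts = \<phi>, iso_arcs = map_prod \<phi> \<phi>, iso_head = snd, iso_tail = fst\<rparr>"
    have inj: "inj_on \<phi> (pverts G)" using R by (simp add: bij_betw_def)
    have "inj_on (map_prod \<phi> \<phi>) (parcs G)"
      by (rule inj_onI) (auto simp: prod_eq_iff fst_map_prod snd_map_prod dest: inj_onD[OF inj] ends)
    then have "pre_digraph.digraph_isomorphism (with_proj G) ?f"
      using wf inj by (auto simp: pre_digraph.digraph_isomorphism_def)
    moreover have "with_proj H = app_iso ?f (with_proj G)"
      using R by (auto simp: with_proj_def app_iso_def bij_betw_def)
    ultimately show "iso_under \<phi> G H" unfolding iso_under_def by force
  qed
qed

(* Every nonempty set of extended naturals contains its infimum, so Inf is the minimum here,
   and it is \<infinity> exactly if no admissible k exists. *)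
definition alpha :: "'a pair_pre_digraph \<Rightarrow> ('a \<Rightarrow> nat) \<Rightarrow> enat" where
  "alpha G \<gamma> = Inf (enat ` {k. \<exists>\<tau>. length \<tau> = card (pverts G) \<and> set \<tau> \<subseteq> {1..k} \<and>
      iso_under (the_inv_into (pverts G) \<gamma>) (PermDAG \<tau>) G})"

definition E_arcs :: "'a pair_pre_digraph \<Rightarrow> ('a \<Rightarrow> nat) \<Rightarrow> ('a \<times> 'a) set" where
  "E_arcs G \<gamma> = {(u, v). u \<in> pverts G \<and> v \<in> pverts G \<and> \<gamma> u < \<gamma> v \<and> (v, u) \<notin> parcs G}"

definition H_graph :: "'a pair_pre_digraph \<Rightarrow> ('a \<Rightarrow> nat) \<Rightarrow> 'a pair_pre_digraph" where
  "H_graph G \<gamma> = \<lparr> pverts = pverts G, parcs = parcs G \<union> E_arcs G \<gamma> \<rparr>"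

(* For a topological ordering the two kinds of arcs of H_graph are disjoint, so the arcs of weight 1
   are exactly those of E_arcs. *)
definition arc_weight :: "'a pair_pre_digraph \<Rightarrow> 'a \<times> 'a \<Rightarrow> nat" where
  "arc_weight G e = (if e \<in> parcs G then 0 else 1)"

end

theory Submission
  imports Defs
begin

text \<open>
  A sequence \<open>\<tau>\<close> realises \<open>(G, \<gamma>)\<close> iff it decreases by at least \<open>w e\<close> along every arc \<open>e\<close> of
  \<open>H(G, \<gamma>)\<close>, i.e. iff it is a potential for \<open>w\<close>. Telescoping along a path shows that the range of
  any potential is at least as wide as the weight of the path. Conversely, the maximal weight of a
  path starting in a vertex is itself a potential: an arc \<open>e\<close> can be prepended to a maximal path,
  unless this closes a cycle, and the existence of some potential forces all cycles to have weight
  zero.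
\<close>

section \<open>Potentials and path weights in a digraph\<close>

context wf_digraph
begin

lemma awalk_weight_le_potential_drop:
  fixes w :: "'b \<Rightarrow> nat" and p :: "'a \<Rightarrow> nat"
  assumes pot: "\<And>e. e \<in> arcs G \<Longrightarrow> w e + p (head G e) \<le> p (tail G e)"
    and "awalk u P v"
  shows "sum w (set P) + p v \<le> p u"
  using assms(2)
proof (induction P arbitrary: u)
  case Nil
  then show ?case by (simp add: awalk_Nil_iff)
next
  case (Cons e P)
  then have "e \<in> arcs G" "u = tail G e" "awalk (head G e) P v"
    by (auto simp: awalk_Cons_iff)
  \<comment> \<open>Summing over the set of arcs counts a repeated arc once, so only an inequality
    holds; it points in the required direction.\<close>
  moreover have "sum w (set (e # P)) \<le> w e + sum w (set P)"
    by (simp add: sum.insert_if)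
  ultimately show ?case
    using Cons.IH[of "head G e"] pot[of e] by fastforce
qed

definition apath_weights_from :: "('b \<Rightarrow> nat) \<Rightarrow> 'a \<Rightarrow> nat set" where
  "apath_weights_from w u = {sum w (set P) | P v. apath u P v}"

text \<open>This makes \<open>Max\<close> meaningful below. The weights are naturals, and the
  potential bounds them by \<open>p u\<close>.\<close>

lemma finite_apath_weights_from:
  fixes p :: "'a \<Rightarrow> nat"
  assumes "\<And>e. e \<in> arcs G \<Longrightarrow> w e + p (head G e) \<le> p (tail G e)"
  shows "finite (apath_weights_from w u)"
proof (rule finite_subset)
  show "apath_weights_from w u \<subseteq> {..p u}"
  proof
    fix x assume "x \<in> apath_weights_from w u"
    then obtain P v where "awalk u P v" and "x = sum w (set P)"
      by (auto simp: apath_weights_from_def apath_def)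
    then show "x \<in> {..p u}"
      using awalk_weight_le_potential_drop[of w p, OF assms, of u P v] by simp
  qed
qed simp

lemma apath_weights_from_nonempty:
  assumes "u \<in> verts G"
  shows "apath_weights_from w u \<noteq> {}"
proof -
  have "apath u [] u" using assms by (simp add: apath_Nil_iff)
  then show ?thesis unfolding apath_weights_from_def by blast
qed

lemma Max_apath_weights_from_potential:
  fixes p :: "'a \<Rightarrow> nat"
  assumes pot: "\<And>e. e \<in> arcs G \<Longrightarrow> w e + p (head G e) \<le> p (tail G e)"
    and e: "e \<in> arcs G"
  shows "w e + Max (apath_weights_from w (head G e)) \<le> Max (apath_weights_from w (tail G e))"
proof -
  let ?x = "tail G e" and ?y = "head G e"
  note fin = finite_apath_weights_from[of w p, OF pot]
  have "Max (apath_weights_from w ?y) \<in> apath_weights_from w ?y"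
    using e by (intro Max_in fin apath_weights_from_nonempty) simp_all
  then obtain P v where P: "apath ?y P v" and max: "Max (apath_weights_from w ?y) = sum w (set P)"
    by (auto simp: apath_weights_from_def)
  have le: "sum w (set R) \<le> Max (apath_weights_from w ?x)" if "apath ?x R v" for R
    using that by (intro Max_ge fin) (auto simp: apath_weights_from_def)
  show ?thesis
  proof (cases "?x \<in> set (awalk_verts ?y P)")
    case False
    then have "apath ?x (e # P) v"
      using e P by (simp add: apath_Cons_iff)
    \<comment> \<open>Otherwise \<open>P\<close> would visit the tail of \<open>e\<close>. Hence
      \<open>w e\<close> really is a new summand of the sum over \<open>set (e # P)\<close>.\<close>
    moreover have "e \<notin> set P"
      using False P by (auto simp: apath_def awalk_def set_awalk_verts_cas)
    ultimately show ?thesis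
      using le[of "e # P"] max by simp
  next
    case True
    \<comment> \<open>Cut \<open>P\<close> at \<open>?x\<close> into \<open>Q\<close> from
      \<open>?y\<close> to \<open>?x\<close> and \<open>R\<close> from \<open>?x\<close> to
      \<open>v\<close>; then \<open>e\<close> followed by \<open>Q\<close> is a closed walk.\<close>
    then obtain xs ys where "awalk_verts ?y P = xs @ ?x # ys"
      by (meson split_list)
    moreover have "cas ?y P v"
      using P by (auto simp: apath_def)
    ultimately obtain Q R where QR: "P = Q @ R" and "cas ?y Q ?x"
      by (metis awalk_decomp_verts)
    then have last: "awlast ?y Q = ?x"
      by (simp add: awlast_if_cas)
    have Q: "awalk ?y Q ?x" and R: "apath ?x R v"
      using P unfolding QR apath_append_iff last by (auto simp: apath_def)
    \<comment> \<open>Combined with the inequality for \<open>e\<close>, which bounds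
      \<open>p ?y\<close> by \<open>p ?x\<close>, this leaves no room for weight on the closed walk.
      So \<open>R\<close>, a path starting in \<open>?x\<close>, carries all the weight of
      \<open>P\<close>.\<close>
    have "sum w (set Q) + p ?x \<le> p ?y"
      by (rule awalk_weight_le_potential_drop[OF pot Q])
    then have "w e = 0" "sum w (set Q) = 0"
      using pot[OF e] by linarith+
    moreover have "sum w (set P) \<le> sum w (set Q) + sum w (set R)"
      unfolding QR set_append by (simp add: sum_Un_nat)
    ultimately show ?thesis
      using le[OF R] max by linarith
  qed
qed

end

section \<open>Realising sequences as potentials on \<open>H_graph\<close>\<close>

lemma pair_wf_digraph_PermDAG: "pair_wf_digraph (PermDAG \<tau>)"
  by unfold_locales (auto simp: PermDAG_def)

text \<open>Supplies the well-formedness of \<open>G\<close> once a realising sequence is known: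
  arcs of \<open>G\<close> are images of arcs of \<open>PermDAG \<tau>\<close>, so their ends are
  images of vertices.\<close>

lemma iso_under_PermDAG_imp_wf:
  assumes "iso_under \<phi> (PermDAG \<tau>) G"
  shows "pair_wf_digraph G"
proof
  have "bij_betw \<phi> (pverts (PermDAG \<tau>)) (pverts G)"
    and "parcs G = map_prod \<phi> \<phi> ` parcs (PermDAG \<tau>)"
    using assms by (simp_all add: iso_under_iff[OF pair_wf_digraph_PermDAG])
  then show "fst e \<in> pverts G" "snd e \<in> pverts G" if "e \<in> parcs G" for e
    using that by (auto simp: PermDAG_def bij_betw_def)
qed

text \<open>The prescribed map sends \<open>t_i\<close> to the vertex at position \<open>i\<close>
  of \<gamma>, so \<open>\<tau> ! (\<gamma> v - 1)\<close> is the entry belonging to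
  \<open>v\<close>. Both graphs have arcs only from later to earlier vertices, so it suffices to
  compare pairs with \<open>\<gamma> u < \<gamma> v\<close>.\<close>

lemma iso_under_PermDAG_iff:
  assumes "pair_wf_digraph G" and top: "topological_ordering G \<gamma>"
    and len: "length \<tau> = card (pverts G)"
  shows "iso_under (the_inv_into (pverts G) \<gamma>) (PermDAG \<tau>) G \<longleftrightarrow>
    (\<forall>u \<in> pverts G. \<forall>v \<in> pverts G. \<gamma> u < \<gamma> v \<longrightarrow>
      ((v, u) \<in> parcs G \<longleftrightarrow> \<tau> ! (\<gamma> u - 1) \<le> \<tau> ! (\<gamma> v - 1)))"
proof -
  interpret pair_wf_digraph G by fact
  let ?\<phi> = "the_inv_into (pverts G) \<gamma>"
  have bij: "bij_betw \<gamma> (pverts G) {1..length \<tau>}"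
    using top len by (simp add: topological_ordering_def)
  then have bij': "bij_betw ?\<phi> {1..length \<tau>} (pverts G)"
    by (rule bij_betw_the_inv_into)
  have \<phi>\<gamma>: "?\<phi> (\<gamma> u) = u" "1 \<le> \<gamma> u" "\<gamma> u \<le> length \<tau>" if "u \<in> pverts G" for u
    using bij that by (auto simp: bij_betw_def the_inv_into_f_f)
  have \<gamma>\<phi>: "\<gamma> (?\<phi> i) = i" "?\<phi> i \<in> pverts G" if "i \<in> {1..length \<tau>}" for i
    using bij bij' that by (auto simp: f_the_inv_into_f_bij_betw bij_betw_def)
  let ?A = "{(v, u). u \<in> pverts G \<and> v \<in> pverts G \<and> \<gamma> u < \<gamma> v \<and>
      \<tau> ! (\<gamma> u - 1) \<le> \<tau> ! (\<gamma> v - 1)}"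
  have "map_prod ?\<phi> ?\<phi> ` parcs (PermDAG \<tau>) = ?A"
  proof
    show "map_prod ?\<phi> ?\<phi> ` parcs (PermDAG \<tau>) \<subseteq> ?A"
      using \<gamma>\<phi> by (auto simp: PermDAG_def)
    show "?A \<subseteq> map_prod ?\<phi> ?\<phi> ` parcs (PermDAG \<tau>)"
    proof clarify
      fix v u
      assume "u \<in> pverts G" "v \<in> pverts G" "\<gamma> u < \<gamma> v" "\<tau> ! (\<gamma> u - 1) \<le> \<tau> ! (\<gamma> v - 1)"
      then have "(\<gamma> v, \<gamma> u) \<in> parcs (PermDAG \<tau>)" "(v, u) = map_prod ?\<phi> ?\<phi> (\<gamma> v, \<gamma> u)"
        using \<phi>\<gamma> by (auto simp: PermDAG_def)
      then show "(v, u) \<in> map_prod ?\<phi> ?\<phi> ` parcs (PermDAG \<tau>)"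
        by (rule rev_image_eqI)
    qed
  qed
  moreover have "pverts (PermDAG \<tau>) = {1..length \<tau>}"
    by (simp add: PermDAG_def)
  ultimately have "iso_under ?\<phi> (PermDAG \<tau>) G \<longleftrightarrow> parcs G = ?A"
    using bij' by (simp add: iso_under_iff[OF pair_wf_digraph_PermDAG])
  moreover have "u \<in> pverts G" "v \<in> pverts G" "\<gamma> u < \<gamma> v" if "(v, u) \<in> parcs G" for u v
    using that top in_arcsD1 in_arcsD2 by (auto simp: topological_ordering_def)
  ultimately show ?thesis
    by blast
qed

text \<open>Each pair \<open>\<gamma> u < \<gamma> v\<close> contributes exactly one arc to
  \<open>H_graph\<close>: \<open>(v, u)\<close> of weight 0 demands a weak inequality of entries,
  \<open>(u, v)\<close> of weight 1 demands the strict opposite, which over the naturals is a gap of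
  at least 1.\<close>

lemma iso_under_PermDAG_iff_potential:
  assumes wf: "pair_wf_digraph G" and top: "topological_ordering G \<gamma>"
    and len: "length \<tau> = card (pverts G)"
  shows "iso_under (the_inv_into (pverts G) \<gamma>) (PermDAG \<tau>) G \<longleftrightarrow>
    (\<forall>(u, v) \<in> parcs (H_graph G \<gamma>).
      arc_weight G (u, v) + \<tau> ! (\<gamma> v - 1) \<le> \<tau> ! (\<gamma> u - 1))"
proof -
  interpret pair_wf_digraph G by fact
  have arc: "u \<in> pverts G" "v \<in> pverts G" "\<gamma> u < \<gamma> v" if "(v, u) \<in> parcs G" for u v
    using that top in_arcsD1 in_arcsD2 by (auto simp: topological_ordering_def)
  \<comment> \<open>Arcs of \<open>E_arcs\<close> ascend in \<gamma> while arcs of \<open>G\<close>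
    descend, so the two kinds never overlap.\<close>
  have "arc_weight G (u, v) = 1" if "(u, v) \<in> E_arcs G \<gamma>" for u v
    using that arc(3)[of u v] by (auto simp: E_arcs_def arc_weight_def)
  moreover have "arc_weight G (u, v) = 0" if "(u, v) \<in> parcs G" for u v
    using that by (simp add: arc_weight_def)
  ultimately have "(\<forall>(u, v) \<in> parcs (H_graph G \<gamma>).
      arc_weight G (u, v) + \<tau> ! (\<gamma> v - 1) \<le> \<tau> ! (\<gamma> u - 1)) \<longleftrightarrow>
    (\<forall>(u, v) \<in> parcs G. \<tau> ! (\<gamma> v - 1) \<le> \<tau> ! (\<gamma> u - 1)) \<and>
    (\<forall>(u, v) \<in> E_arcs G \<gamma>. \<tau> ! (\<gamma> v - 1) < \<tau> ! (\<gamma> u - 1))"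
    by (auto simp: H_graph_def ball_Un Suc_le_eq)
  also have "\<dots> \<longleftrightarrow> (\<forall>u \<in> pverts G. \<forall>v \<in> pverts G. \<gamma> u < \<gamma> v \<longrightarrow>
      ((v, u) \<in> parcs G \<longleftrightarrow> \<tau> ! (\<gamma> u - 1) \<le> \<tau> ! (\<gamma> v - 1)))"
    (is "?L \<longleftrightarrow> ?R")
  proof
    show "?L \<Longrightarrow> ?R"
      unfolding E_arcs_def not_le[symmetric] by blast
    assume R: ?R
    have "\<tau> ! (\<gamma> v - 1) \<le> \<tau> ! (\<gamma> u - 1)" if "(u, v) \<in> parcs G" for u v
      using R arc[OF that] that by blast
    moreover have "\<tau> ! (\<gamma> v - 1) < \<tau> ! (\<gamma> u - 1)" if "(u, v) \<in> E_arcs G \<gamma>" for u v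
    proof -
      have "u \<in> pverts G" "v \<in> pverts G" "\<gamma> u < \<gamma> v" "(v, u) \<notin> parcs G"
        using that by (simp_all add: E_arcs_def)
      then have "\<not> \<tau> ! (\<gamma> u - 1) \<le> \<tau> ! (\<gamma> v - 1)"
        using R by blast
      then show ?thesis
        by (rule not_le_imp_less)
    qed
    ultimately show ?L
      by blast
  qed
  finally show ?thesis
    using iso_under_PermDAG_iff[OF assms] by simp
qed

section \<open>The least range of a potential\<close>

theorem theorem3:
  fixes G :: "'a pair_pre_digraph" and \<gamma> :: "'a \<Rightarrow> nat"
  assumes "permutation_DAG G"
    and "pverts G \<noteq> {}"
    and "topological_ordering G \<gamma>"
    and "alpha G \<gamma> \<noteq> \<infinity>"
  shows "alpha G \<gamma> = enat (1 + Max {(\<Sum>e \<in> set P. arc_weight G e) | P u v.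
           pre_digraph.apath (with_proj (H_graph G \<gamma>)) u P v})"
proof -
  let ?V = "pverts G" and ?w = "arc_weight G"
  let ?\<phi> = "the_inv_into ?V \<gamma>"
  define S where "S = {k. \<exists>\<tau>. length \<tau> = card ?V \<and> set \<tau> \<subseteq> {1..k} \<and>
      iso_under ?\<phi> (PermDAG \<tau>) G}"
  have alpha: "alpha G \<gamma> = Inf (enat ` S)"
    by (simp add: alpha_def S_def)
  \<comment> \<open>The infimum of the empty set is \<open>\<infinity>\<close>. The resulting
    \<sigma> serves as the potential that bounds all path weights.\<close>
  with assms(4) have "S \<noteq> {}"
    by (auto simp: Inf_enat_def)
  then obtain \<sigma> where \<sigma>: "length \<sigma> = card ?V" "iso_under ?\<phi> (PermDAG \<sigma>) G"
    by (auto simp: S_def)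
  then have wf: "pair_wf_digraph G"
    by (blast intro: iso_under_PermDAG_imp_wf)
  have bij: "bij_betw \<gamma> ?V {1..card ?V}"
    using assms(3) by (simp add: topological_ordering_def)
  then have finV: "finite ?V"
    using bij_betw_finite by blast
  have \<gamma>: "1 \<le> \<gamma> v" "\<gamma> v \<le> card ?V" "?\<phi> (\<gamma> v) = v" if "v \<in> ?V" for v
    using bij that by (auto simp: bij_betw_def the_inv_into_f_f)
  interpret G: pair_wf_digraph G by (fact wf)
  interpret H: pair_wf_digraph "H_graph G \<gamma>"
    by unfold_locales
      (auto simp: H_graph_def E_arcs_def dest: G.arc_fst_in_verts G.arc_snd_in_verts)
  have verts_H: "verts (with_proj (H_graph G \<gamma>)) = ?V"
    by (simp add: H_graph_def)
  have potential: "?w e + \<tau> ! (\<gamma> (snd e) - 1) \<le> \<tau> ! (\<gamma> (fst e) - 1)"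
    if "length \<tau> = card ?V" "iso_under ?\<phi> (PermDAG \<tau>) G" "e \<in> parcs (H_graph G \<gamma>)" for \<tau> e
    using that iso_under_PermDAG_iff_potential[OF wf assms(3), of \<tau>] by (cases e) auto
  note pot\<sigma> = potential[OF \<sigma>]

  define D where "D u = Max (H.apath_weights_from ?w u)" for u
  define W where "W = {sum ?w (set P) | P u v. H.apath u P v}"
  \<comment> \<open>Grouping paths by their first vertex reduces finiteness of \<open>W\<close> to
    finitely many finite sets.\<close>
  have W_eq: "W = (\<Union>u \<in> ?V. H.apath_weights_from ?w u)"
    using verts_H by (auto simp: W_def H.apath_weights_from_def H.apath_def H.awalk_def)
  have fin: "finite (H.apath_weights_from ?w u)" for u
    using H.finite_apath_weights_from[of ?w "\<lambda>v. \<sigma> ! (\<gamma> v - 1)"] pot\<sigma> by simp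
  have finW: "finite W"
    using finV fin by (simp add: W_eq)
  have neW: "W \<noteq> {}"
    using assms(2) H.apath_weights_from_nonempty verts_H by (auto simp: W_eq)
  have D_le: "D u \<le> Max W" if "u \<in> ?V" for u
    unfolding D_def using that H.apath_weights_from_nonempty[of u ?w] verts_H
    by (intro Max_mono finW) (auto simp: W_eq)

  \<comment> \<open>The maximal path weight \<open>D\<close> may be 0 while entries start at 1,
    hence the shift by 1; list index \<open>i\<close> belongs to the vertex at position
    \<open>i + 1\<close>.\<close>
  define \<tau> where "\<tau> = map (\<lambda>i. 1 + D (?\<phi> (i + 1))) [0..<card ?V]"
  have \<tau>_nth: "\<tau> ! (\<gamma> v - 1) = 1 + D v" if "v \<in> ?V" for v
  proof -
    have "\<gamma> v - 1 < card ?V" "\<gamma> v - 1 + 1 = \<gamma> v"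
      using \<gamma>[OF that] by linarith+
    then show ?thesis
      using \<gamma>(3)[OF that] by (simp add: \<tau>_def)
  qed
  have "1 + Max W \<in> S"
  proof -
    have len: "length \<tau> = card ?V" by (simp add: \<tau>_def)
    have "?\<phi> (i + 1) \<in> ?V" if "i < card ?V" for i
      using bij_betw_the_inv_into[OF bij] that by (auto simp: bij_betw_def)
    then have range: "set \<tau> \<subseteq> {1..1 + Max W}"
      using D_le by (auto simp: \<tau>_def)
    have "?w (u, v) + \<tau> ! (\<gamma> v - 1) \<le> \<tau> ! (\<gamma> u - 1)" if "(u, v) \<in> parcs (H_graph G \<gamma>)" for u v
    proof -
      have "?w (u, v) + D v \<le> D u"
        using H.Max_apath_weights_from_potential[of ?w "\<lambda>v. \<sigma> ! (\<gamma> v - 1)" "(u, v)"] pot\<sigma> that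
        by (simp add: D_def)
      moreover have "u \<in> ?V" "v \<in> ?V"
        using H.in_arcsD1[OF that] H.in_arcsD2[OF that] verts_H by simp_all
      ultimately show ?thesis
        using \<tau>_nth[of u] \<tau>_nth[of v] by linarith
    qed
    then have "iso_under ?\<phi> (PermDAG \<tau>) G"
      using iso_under_PermDAG_iff_potential[OF wf assms(3) len] by blast
    with len range show ?thesis
      by (auto simp: S_def)
  qed
  moreover have "1 + Max W \<le> k" if "k \<in> S" for k
  proof -
    from that obtain \<rho> where \<rho>: "length \<rho> = card ?V" "iso_under ?\<phi> (PermDAG \<rho>) G"
      and range: "set \<rho> \<subseteq> {1..k}"
      by (auto simp: S_def)
    \<comment> \<open>Along a heaviest path the entries of \<rho> drop by at least
      \<open>Max W\<close>, from at most \<open>k\<close> to at least 1.\<close>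
    have "Max W \<in> W"
      using finW neW by (rule Max_in)
    then obtain P u v where P: "H.awalk u P v" and max: "Max W = sum ?w (set P)"
      by (auto simp: W_def H.apath_def)
    have "sum ?w (set P) + \<rho> ! (\<gamma> v - 1) \<le> \<rho> ! (\<gamma> u - 1)"
      using potential[OF \<rho>] P
      by (intro H.awalk_weight_le_potential_drop[where p = "\<lambda>v. \<rho> ! (\<gamma> v - 1)"]) simp_all
    moreover have "\<rho> ! (\<gamma> x - 1) \<in> {1..k}" if "x \<in> ?V" for x
      using range \<gamma>[OF that] \<rho>(1) by (intro subsetD[OF range] nth_mem) simp
    then have "\<rho> ! (\<gamma> u - 1) \<le> k" "1 \<le> \<rho> ! (\<gamma> v - 1)"
      using H.awalk_hd_in_verts[OF P] H.awalk_last_in_verts[OF P] verts_H by auto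
    ultimately show ?thesis
      using max by linarith
  qed
  ultimately have "Inf (enat ` S) = enat (1 + Max W)"
    by (intro antisym Inf_lower Inf_greatest) auto
  then show ?thesis
    by (simp add: alpha W_def)
qed

end
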